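(* Let $\mathbb H^3\cong SL(2,\mathbb C)/SU(2)$ be the 3-dimensional real hyperbolic space (of constant sectional curvature $-1$), and let $\alpha<1/4$. Then the maximal inequality $$\Big\|\sup_{0<t<1}|S_tf|\Big\|_{L^1(B_R)}\le c\,\|f\|_{H^\alpha(\mathbb H^3)}\qquad\text{for all radial } L^2\text{-Schwartz class functions } f \text{ on } \mathbb H^3$$ fails; that is, it is not true that for every $R>0$ there is a finite constant $c>0$ (independent of $f$) for which this inequality holds.
   Context: Radial functions on $\mathbb H^3$ are functions of the geodesic distance $s\ge0$ from a fixed base point $o$ (equivalently, $SU(2)$-biinvariant functions on $SL(2,\mathbb C)$); $B_R$ is the geodesic ball of radius $R$ centered at $o$. Up to normalization, the Riemannian volume of a radial function is $\int_0^\infty f(s)\sinh^2 s\,ds$, and $L^1(B_R)$ is with respect to this measure. The spherical functions are $$\varphi_\lambda(s)=\frac{\sin(\lambda s)}{\lambda\sinh s},\qquad \lambda>0,$$ the spherical Fourier transform is $\hat f(\lambda)=\int_0^\infty f(s)\varphi_\lambda(s)\sinh^2 s\,ds$, and the Plancherel measure is (up to normalization) $\lambda^2\,d\lambda$ on $(0,\infty)$. Here $Q=2$, so $Q^2/4=1$ and $4/Q^2=1$. The radial $L^2$-Schwartz class consists of the smooth radial functions $f$ on $\mathbb H^3$ with $\sup_{s\ge0}(1+s)^k e^{s}\left|\frac{d^m}{ds^m}f(s)\right|<\infty$ for all integers $k,m\ge0$. For such $f$, $$S_tf(s)=\int_0^\infty\varphi_\lambda(s)\,e^{it(\lambda^2+1)}\,\hat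 f(\lambda)\,\lambda^2\,d\lambda,\qquad \|f\|_{H^\alpha(\mathbb H^3)}=\left(\int_0^\infty(\lambda^2+1)^\alpha|\hat f(\lambda)|^2\lambda^2\,d\lambda\right)^{1/2}.$$ *)

theory Defs
  imports "HOL-Analysis.Analysis"
begin

text \<open>
  Hyperbolic 3-space of curvature $-1$ in the Poincare ball model. The carrier is the open
  Euclidean unit ball, an open subset of \<open>real ^ 3\<close>, so smoothness on hyperbolic space is
  ordinary smoothness there. The base point $o$ is the centre of the ball.
\<close>

definition hyp3 :: "(real ^ 3) set" where
  "hyp3 = ball 0 1"

definition hyp_dist :: "real ^ 3 \<Rightarrow> real ^ 3 \<Rightarrow> real" where
  "hyp_dist x y =
     arcosh (1 + 2 * (norm (x - y))\<^sup>2 / ((1 - (norm x)\<^sup>2) * (1 - (norm y)\<^sup>2)))"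

definition hyp_origin :: "real ^ 3" where
  "hyp_origin = 0"

text \<open>\<open>Ck_on k f S\<close> says that \<open>f\<close> is $k$ times continuously differentiable on the open set \<open>S\<close>.\<close>

primrec Ck_on ::
  "nat \<Rightarrow> ('a::real_normed_vector \<Rightarrow> 'b::real_normed_vector) \<Rightarrow> 'a set \<Rightarrow> bool" where
  "Ck_on 0 f S \<longleftrightarrow> continuous_on S f"
| "Ck_on (Suc k) f S \<longleftrightarrow>
     (\<forall>x\<in>S. f differentiable (at x)) \<and>
     (\<forall>v. Ck_on k (\<lambda>x. frechet_derivative f (at x) v) S)"

definition smooth_on ::
  "('a::real_normed_vector \<Rightarrow> 'b::real_normed_vector) \<Rightarrow> 'a set \<Rightarrow> bool" where
  "smooth_on f S \<longleftrightarrow> (\<forall>k. Ck_on k f S)"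

text \<open>
  A radial function on hyperbolic space is given by its profile \<open>f :: real \<Rightarrow> complex\<close>, a function
  of the geodesic distance $s \ge 0$ from the base point; the values of \<open>f\<close> at negative
  arguments are never used. Accordingly the $s$-derivatives are taken within $[0,\infty)$, that
  is, they are one-sided at $s = 0$.
\<close>

definition radial_deriv :: "nat \<Rightarrow> (real \<Rightarrow> complex) \<Rightarrow> real \<Rightarrow> complex" where
  "radial_deriv m = (\<lambda>g s. vector_derivative g (at s within {0..})) ^^ m"

definition radial_L2_schwartz :: "(real \<Rightarrow> complex) \<Rightarrow> bool" where
  "radial_L2_schwartz f \<longleftrightarrow>
     smooth_on (\<lambda>x. f (hyp_dist hyp_origin x)) hyp3 \<and>
     (\<forall>k m. bdd_above ((\<lambda>s. (1 + s) ^ k * exp s * norm (radial_deriv m f s)) ` {0..}))"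

text \<open>
  The quotient defining the spherical function has a removable singularity at $s = 0$, where
  HOL division would give the value $0$ instead of the limit $1$.
\<close>

definition spherical_fun :: "real \<Rightarrow> real \<Rightarrow> real" where
  "spherical_fun \<nu> s = (if s = 0 then 1 else sin (\<nu> * s) / (\<nu> * sinh s))"

definition spherical_transform :: "(real \<Rightarrow> complex) \<Rightarrow> real \<Rightarrow> complex" where
  "spherical_transform f \<nu> =
     (LINT s:{0<..}|lborel. f s * of_real (spherical_fun \<nu> s * (sinh s)\<^sup>2))"

definition schroedinger :: "real \<Rightarrow> (real \<Rightarrow> complex) \<Rightarrow> real \<Rightarrow> complex" where
  "schroedinger t f s =
     (LINT \<nu>:{0<..}|lborel.
        of_real (spherical_fun \<nu> s) * exp (\<i> * of_real (t * (\<nu>\<^sup>2 + 1))) *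
        spherical_transform f \<nu> * of_real (\<nu>\<^sup>2))"

definition sobolev_norm :: "real \<Rightarrow> (real \<Rightarrow> complex) \<Rightarrow> real" where
  "sobolev_norm \<alpha> f =
     sqrt (LINT \<nu>:{0<..}|lborel.
        (\<nu>\<^sup>2 + 1) powr \<alpha> * (norm (spherical_transform f \<nu>))\<^sup>2 * \<nu>\<^sup>2)"

text \<open>
  The maximal function and its norm are extended nonnegative, so that an unbounded supremum or a
  divergent integral is infinite rather than a junk real number.
\<close>

definition schroedinger_maximal :: "(real \<Rightarrow> complex) \<Rightarrow> real \<Rightarrow> ennreal" where
  "schroedinger_maximal f s = (SUP t\<in>{0<..<1}. ennreal (norm (schroedinger t f s)))"

definition radial_L1_norm_ball :: "real \<Rightarrow> (real \<Rightarrow> ennreal) \<Rightarrow> ennreal" where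
  "radial_L1_norm_ball R g = (\<integral>\<^sup>+ s\<in>{0..<R}. (g s * ennreal ((sinh s)\<^sup>2)) \<partial>lborel)"

end

theory Submission
  imports
    Defs
    "HOL-Complex_Analysis.Complex_Analysis"
    "HOL-Probability.Distributions"
    "HOL-Real_Asymp.Real_Asymp"
begin

text \<open>
  On hyperbolic 3-space, multiplying a radial function by $\sinh s$ turns the spherical transform
  into the sine transform and the Schroedinger evolution into that of an odd function on the real
  line. The inequality therefore fails for the same reason as the one-dimensional one: a packet of
  frequency $n$ and frequency spread $n^{1/2}$ has spatial width $n^{-1/2}$ and moves with speed
  $2n$ without spreading appreciably during a time $1/n$. In that time it sweeps over an interval of
  fixed length, so its maximal function is as large as its amplitude on a fixed set, whereas its
  $H^\alpha$ norm is only its amplitude times $n^{\alpha - 1/4}$. For $\alpha < 1/4$ and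
  $n \to \infty$ this contradicts the inequality on the ball of radius $4$.

  The packets are chosen such that every integral is an explicit Gaussian:
  $f_n(s) = e^{-a s^2} \sinh(ns) / \sinh s$ with $a = n(1 - i)/8$. As $n$ is an integer, the quotient
  is a polynomial in $\cosh s$, so $f_n$ extends to an even entire function; this makes
  membership in the Schwartz class accessible to Cauchy estimates (\<open>packet_decay\<close>) and to
  power series in $|x|^2$ (\<open>packet_smooth\<close>). The frequency $n$ is produced by the imaginary part of
  the width $a$ and not by an oscillating factor.

  The formula \<open>has_bochner_integral_gaussian_complex\<close> for complex widths and shifts gives both
  the transform (\<open>spherical_transform_packet\<close>) and the evolution (\<open>schroedinger_packet\<close>) in closed
  form. The maximal function then has $L^1$ norm at least $e^{2n}/2$ (\<open>maximal_packet_ge\<close>), and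
  the Sobolev norm is at most a constant times $e^{2n} n^{\beta - 1/4}$ with
  $\beta = \max(\alpha, 0)$ (\<open>sobolev_norm_packet_le\<close>).
\<close>

section \<open>Gaussian integrals with complex parameters\<close>

lemma has_bochner_integral_gaussian_real:
  fixes p m :: real
  assumes "p > 0"
  shows "has_bochner_integral lborel (\<lambda>x. exp (- (p * (x - m)\<^sup>2))) (sqrt (pi / p))"
proof -
  have "has_bochner_integral lborel (\<lambda>x::real. exp (- x\<^sup>2)) (2 *\<^sub>R (sqrt pi / 2))"
    using has_bochner_integral_even_function[OF gaussian_moment_0] by simp
  moreover have "exp (- (p * (m + (1 / sqrt p) * x - m)\<^sup>2)) = exp (- x\<^sup>2)" for x
    using assms by (simp add: power_mult_distrib power_divide)
  ultimately show ?thesis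
    using assms
    by (subst lborel_has_bochner_integral_real_affine_iff[where c = "1 / sqrt p" and t = m])
       (simp_all add: real_sqrt_divide field_simps)
qed

lemma Re_power2_ge:
  fixes z :: complex and m :: real
  assumes "m \<ge> 0" "Re z - \<bar>Im z\<bar> \<ge> m"
  shows "Re (z\<^sup>2) \<ge> m\<^sup>2"
proof -
  have "m\<^sup>2 \<le> (Re z - \<bar>Im z\<bar>) * (Re z + \<bar>Im z\<bar>)"
    unfolding power2_eq_square using assms by (intro mult_mono) auto
  also have "\<dots> = Re (z\<^sup>2)"
    by (simp add: power2_eq_square algebra_simps abs_mult_self_eq)
  finally show ?thesis .
qed

lemma integrable_exp_complex_quadratic:
  fixes z w :: complex
  assumes "Re z > 0"
  shows "integrable lborel (\<lambda>x::real. exp (- z * (of_real x)\<^sup>2 + w * x))"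
proof -
  define m where "m = Re w / (2 * Re z)"
  define C where "C = exp ((Re w)\<^sup>2 / (4 * Re z))"
  have "integrable lborel (\<lambda>x::real. C * exp (- (Re z * (x - m)\<^sup>2)))"
    using has_bochner_integral_gaussian_real[OF assms, of m]
    by (intro integrable_mult_right) (simp add: has_bochner_integral_iff)
  moreover have "norm (exp (- z * (of_real x)\<^sup>2 + w * x)) \<le> norm (C * exp (- (Re z * (x - m)\<^sup>2)))" for x :: real
  proof -
    have "- Re z * x\<^sup>2 + Re w * x = (Re w)\<^sup>2 / (4 * Re z) + - (Re z * (x - m)\<^sup>2)"
      using assms by (simp add: m_def field_simps power2_eq_square)
    moreover have "Re (- z * (of_real x)\<^sup>2 + w * x) = - Re z * x\<^sup>2 + Re w * x"
      by (simp add: power2_eq_square)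
    ultimately have "Re (- z * x\<^sup>2 + w * x) = (Re w)\<^sup>2 / (4 * Re z) + - (Re z * (x - m)\<^sup>2)" by simp
    then have "norm (exp (- z * (of_real x)\<^sup>2 + w * x)) = C * exp (- (Re z * (x - m)\<^sup>2))"
      unfolding C_def exp_add[symmetric] norm_exp_eq_Re by simp
    moreover have "norm (C * exp (- (Re z * (x - m)\<^sup>2))) = C * exp (- (Re z * (x - m)\<^sup>2))"
      by (simp add: C_def)
    ultimately show ?thesis by simp
  qed
  moreover have "(\<lambda>x::real. exp (- z * (of_real x)\<^sup>2 + w * x)) \<in> borel_measurable lborel"
    by (auto intro!: borel_measurable_continuous_onI continuous_intros)
  ultimately show ?thesis
    using Bochner_Integration.integrable_bound[OF _ _ AE_I2] by blast
qed

text \<open>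
  The Gaussian integral over the line $x \mapsto cx + d$ has the value that it has over the real
  axis, as long as the direction $c$ lies in the sector $|\arg c| < \pi/4$, where $e^{-\zeta^2}$
  decays. The function has an entire primitive $E$, so the difference of the two integrals is the
  increment of $E(cx + d) - E(x)$ from $-\infty$ to $\infty$. That quantity tends to $0$ at both ends
  because for large $|x|$ the whole segment from $x$ to $cx + d$ lies in this sector or its negative.
\<close>

lemma integral_gaussian_line:
  fixes c d :: complex
  assumes c: "\<bar>Im c\<bar> < Re c"
  shows "has_bochner_integral lborel (\<lambda>x::real. c * exp (- (c * x + d)\<^sup>2)) (sqrt pi)"
proof -
  have "(\<lambda>z::complex. exp (- z\<^sup>2)) holomorphic_on UNIV"
    by (intro holomorphic_intros)
  then obtain E where "\<And>z::complex. z \<in> UNIV \<Longrightarrow> (E has_field_derivative exp (- z\<^sup>2)) (at z within UNIV)"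
    by (rule holomorphic_convex_primitive'[OF convex_UNIV open_UNIV]) blast
  then have E: "(E has_field_derivative exp (- z\<^sup>2)) (at z)" for z :: complex
    by simp
  \<comment> \<open>A point of the segment from \<open>x\<close> to \<open>c * x + d\<close> is \<open>x * q + u * d\<close> with \<open>q\<close> on the segment from
    \<open>1\<close> to \<open>c\<close>; the constant \<open>m\<close> bounds \<open>Re q - \<bar>Im q\<bar>\<close> from below, \<open>M\<close> bounds \<open>norm q\<close> from above.\<close>
  define m where "m = min 1 (Re c - \<bar>Im c\<bar>)"
  define M where "M = 1 + norm c"
  define D where "D = norm d"
  define G where "G = (\<lambda>x::real. E (c * x + d) - E x)"
  define g where "g = (\<lambda>x::real. c * exp (- (c * x + d)\<^sup>2) - exp (- (of_real x)\<^sup>2))"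
  have m: "m > 0" using c by (simp add: m_def)
  have M: "M > 0" by (simp add: M_def add_pos_nonneg)
  have bound: "norm (G x) \<le> exp (- (m\<^sup>2 * \<bar>x\<bar>\<^sup>2 - 2 * M * D * \<bar>x\<bar> - D\<^sup>2)) * (M * \<bar>x\<bar> + D)" for x
  proof -
    let ?B = "exp (- (m\<^sup>2 * \<bar>x\<bar>\<^sup>2 - 2 * M * D * \<bar>x\<bar> - D\<^sup>2))"
    have "norm (E (c * x + d) - E x) \<le> ?B * norm (c * x + d - x)"
    proof (rule field_differentiable_bound[where S = "closed_segment (of_real x) (c * x + d)"])
      fix y assume "y \<in> closed_segment (of_real x) (c * x + d)"
      then obtain u where u: "0 \<le> u" "u \<le> 1" "y = (1 - u) *\<^sub>R of_real x + u *\<^sub>R (c * x + d)"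
        by (auto simp: in_segment)
      define q where "q = of_real (1 - u) + u * c"
      have y: "y = x * q + u * d"
        by (simp add: u q_def algebra_simps scaleR_conv_of_real)
      have "Re q - \<bar>Im q\<bar> = (1 - u) * 1 + u * (Re c - \<bar>Im c\<bar>)"
        using u by (simp add: q_def abs_mult algebra_simps)
      also have "\<dots> \<ge> (1 - u) * m + u * m"
        using u c by (intro add_mono mult_left_mono) (auto simp: m_def)
      finally have qm: "Re (q\<^sup>2) \<ge> m\<^sup>2"
        using m by (intro Re_power2_ge) (auto simp: algebra_simps)
      have "norm q \<le> (1 - u) * 1 + u * norm c"
        unfolding q_def using u by (intro order.trans[OF norm_triangle_ineq] add_mono)
           (auto simp: norm_mult simp del: of_real_diff)
      also have "\<dots> \<le> 1 * 1 + 1 * norm c"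
        using u by (intro add_mono mult_right_mono) auto
      finally have qM: "norm q \<le> M" by (simp add: M_def)
      have "y\<^sup>2 = of_real (x\<^sup>2) * q\<^sup>2 + 2 * of_real (x * u) * (q * d) + of_real (u\<^sup>2) * d\<^sup>2"
        by (simp add: y power2_eq_square algebra_simps)
      then have "Re (y\<^sup>2) = x\<^sup>2 * Re (q\<^sup>2) + 2 * ((x * u) * Re (q * d)) + u\<^sup>2 * Re (d\<^sup>2)"
        by simp
      moreover have "x\<^sup>2 * Re (q\<^sup>2) \<ge> x\<^sup>2 * m\<^sup>2"
        using qm by (intro mult_left_mono) auto
      moreover have "\<bar>(x * u) * Re (q * d)\<bar> \<le> (\<bar>x\<bar> * 1) * (M * D)"
        unfolding abs_mult D_def using u qM M
        by (intro mult_mono order.trans[OF abs_Re_le_cmod]) (auto simp: norm_mult intro!: mult_mono)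
      moreover have "\<bar>u\<^sup>2 * Re (d\<^sup>2)\<bar> \<le> 1 * D\<^sup>2"
        unfolding abs_mult D_def using u
        by (intro mult_mono order.trans[OF abs_Re_le_cmod]) (auto simp: norm_power power_le_one)
      ultimately have "Re (y\<^sup>2) \<ge> m\<^sup>2 * \<bar>x\<bar>\<^sup>2 - 2 * M * D * \<bar>x\<bar> - D\<^sup>2"
        by (simp add: algebra_simps abs_le_iff)
      then show "norm (exp (- y\<^sup>2)) \<le> ?B"
        by (simp add: norm_exp_eq_Re)
    qed (auto intro: E has_field_derivative_at_within)
    also have "norm (c * x + d - x) \<le> M * \<bar>x\<bar> + D"
    proof -
      have "c * x + d - x = (c - 1) * x + d" by (simp add: algebra_simps)
      also have "norm \<dots> \<le> norm (c - 1) * \<bar>x\<bar> + D"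
        by (intro order.trans[OF norm_triangle_ineq]) (simp add: norm_mult D_def)
      also have "norm (c - 1) * \<bar>x\<bar> \<le> M * \<bar>x\<bar>"
        using norm_triangle_ineq4[of c 1] by (intro mult_right_mono) (auto simp: M_def)
      finally show ?thesis by simp
    qed
    finally show ?thesis
      unfolding G_def by (simp add: mult_left_mono)
  qed
  have "((\<lambda>y. exp (- (m\<^sup>2 * y\<^sup>2 - 2 * M * D * y - D\<^sup>2)) * (M * y + D)) \<longlongrightarrow> 0) at_top"
    using m M by real_asymp
  moreover have "filterlim (\<lambda>x::real. \<bar>x\<bar>) at_top at_infinity"
    using filterlim_at_infinity_conv_norm_at_top[of "\<lambda>x::real. x" at_infinity]
    by (simp add: filterlim_ident)
  ultimately have lim0: "((\<lambda>x. exp (- (m\<^sup>2 * \<bar>x\<bar>\<^sup>2 - 2 * M * D * \<bar>x\<bar> - D\<^sup>2)) * (M * \<bar>x\<bar> + D)) \<longlongrightarrow> 0) at_infinity"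
    by (rule filterlim_compose)
  have G0: "(G \<longlongrightarrow> 0) at_infinity"
    using lim0 by (rule Lim_null_comparison[OF always_eventually, rotated]) (use bound in auto)
  have zc: "Re (c\<^sup>2) > 0"
    using c Re_power2_ge[of "Re c - \<bar>Im c\<bar>" c] by (smt (verit) zero_less_power2)
  have int1: "integrable lborel (\<lambda>x::real. c * exp (- (c * x + d)\<^sup>2))"
  proof -
    have "integrable lborel (\<lambda>x::real. (c * exp (- d\<^sup>2)) * exp (- (c\<^sup>2) * (of_real x)\<^sup>2 + (- 2 * c * d) * x))"
      by (intro integrable_mult_right integrable_exp_complex_quadratic zc)
    moreover have "- (c * x + d)\<^sup>2 = - d\<^sup>2 + (- (c\<^sup>2) * (of_real x)\<^sup>2 + (- 2 * c * d) * x)" for x :: real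
      by (simp add: power2_eq_square algebra_simps)
    ultimately show ?thesis by (simp only: exp_add mult.assoc)
  qed
  have real_gauss: "has_bochner_integral lborel (\<lambda>x::real. exp (- (complex_of_real x)\<^sup>2)) (sqrt pi)"
  proof -
    have "has_bochner_integral lborel (\<lambda>x::real. complex_of_real (exp (- x\<^sup>2))) (sqrt pi)"
      using has_bochner_integral_gaussian_real[of 1 0] by (intro has_bochner_integral_of_real) simp
    then show ?thesis by (simp add: exp_of_real[symmetric])
  qed
  have "(LBINT x=-\<infinity>..\<infinity>. g x) = 0 - 0"
  proof (rule interval_integral_FTC_integrable[where F = G])
    show "(G has_vector_derivative g x) (at x)" for x
    proof -
      have "((\<lambda>w. E (c * w + d) - E w) has_field_derivative
              exp (- (c * of_real x + d)\<^sup>2) * c - exp (- (of_real x)\<^sup>2)) (at (of_real x))"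
        by (intro DERIV_diff DERIV_chain2[OF E] E) (auto intro!: derivative_eq_intros)
      from has_vector_derivative_real_field[OF this] show ?thesis
        by (simp add: G_def g_def mult.commute)
    qed
    show "isCont g x" for x
      unfolding g_def by (intro continuous_intros)
    show "set_integrable lborel (einterval (- \<infinity>) \<infinity>) g"
      using Bochner_Integration.integrable_diff[OF int1 integrable.intros[OF real_gauss]]
      by (simp add: set_integrable_def einterval_def g_def)
    show "((G \<circ> real_of_ereal) \<longlongrightarrow> 0) (at_right (- \<infinity>))"
      using G0 by (simp add: ereal_tendsto_simps tendsto_mono[OF at_bot_le_at_infinity])
    show "((G \<circ> real_of_ereal) \<longlongrightarrow> 0) (at_left \<infinity>)"
      using G0 by (simp add: ereal_tendsto_simps tendsto_mono[OF at_top_le_at_infinity])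
  qed auto
  then have "(LINT x|lborel. g x) = 0"
    by (simp add: interval_lebesgue_integral_def einterval_def set_lebesgue_integral_def)
  then have "(LINT x|lborel. c * exp (- (c * of_real x + d)\<^sup>2)) = sqrt pi"
    using int1 real_gauss by (simp add: g_def has_bochner_integral_iff)
  with int1 show ?thesis by (simp add: has_bochner_integral_iff)
qed

text \<open>
  Completing the square with $c = \sqrt z$; the condition $\mathrm{Re}\, z > 0$ says exactly that
  $c$ lies in the sector $|\arg c| < \pi/4$.
\<close>

lemma has_bochner_integral_gaussian_complex:
  fixes z w :: complex
  assumes "Re z > 0"
  shows "has_bochner_integral lborel (\<lambda>x::real. exp (- z * (of_real x)\<^sup>2 + w * x))
           (sqrt pi / csqrt z * exp (w\<^sup>2 / (4 * z)))"
proof -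
  define c where "c = csqrt z"
  have z: "z = c\<^sup>2" by (simp add: c_def)
  have "Re c \<ge> 0" unfolding c_def by (rule Re_csqrt)
  moreover have "\<bar>Im c\<bar>\<^sup>2 < (Re c)\<^sup>2" using assms by (simp add: z power2_eq_square)
  ultimately have c: "\<bar>Im c\<bar> < Re c" using power2_less_imp_less by blast
  then have c0: "c \<noteq> 0" by auto
  define d where "d = - w / (2 * c)"
  have "exp (- z * (of_real x)\<^sup>2 + w * x) = (exp (w\<^sup>2 / (4 * z)) / c) * (c * exp (- (c * x + d)\<^sup>2))" for x :: real
  proof -
    have *: "- z * (of_real x)\<^sup>2 + w * x = w\<^sup>2 / (4 * z) + - (c * x + d)\<^sup>2"
      using c0 by (simp add: z d_def field_simps power2_eq_square)
    show ?thesis unfolding * exp_add using c0 by simp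
  qed
  moreover have "has_bochner_integral lborel (\<lambda>x::real. (exp (w\<^sup>2 / (4 * z)) / c) * (c * exp (- (c * x + d)\<^sup>2)))
      ((exp (w\<^sup>2 / (4 * z)) / c) * sqrt pi)"
    by (intro has_bochner_integral_mult_right integral_gaussian_line c)
  ultimately show ?thesis by (simp add: c_def mult.commute)
qed

lemma set_integral_even:
  fixes h :: "real \<Rightarrow> complex"
  assumes h: "has_bochner_integral lborel h I" and even: "\<And>x. h (- x) = h x"
  shows "(LINT x:{0<..}|lborel. h x) = I / 2"
proof -
  have int: "integrable lborel (\<lambda>x. indicator {0<..} x *\<^sub>R h x)" "integrable lborel (\<lambda>x. indicator {..<0} x *\<^sub>R h x)"
    using h by (auto intro!: integrable_mult_indicator simp: has_bochner_integral_iff)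
  have "I = (LINT x|lborel. h x)" using h by (simp add: has_bochner_integral_iff)
  also have "\<dots> = (LINT x|lborel. indicator {0<..} x *\<^sub>R h x + indicator {..<0} x *\<^sub>R h x)"
    by (rule integral_cong_AE)
       (use h AE_lborel_singleton[of 0] in \<open>auto simp: has_bochner_integral_iff split: split_indicator elim!: eventually_mono\<close>)
  also have "\<dots> = (LINT x|lborel. indicator {0<..} x *\<^sub>R h x) + (LINT x|lborel. indicator {..<0} x *\<^sub>R h x)"
    using int by (rule Bochner_Integration.integral_add)
  also have "(LINT x|lborel. indicator {..<0} x *\<^sub>R h x) = (LINT x|lborel. indicator {0<..} x *\<^sub>R h x)"
    by (subst lborel_integral_real_affine[where c = "-1" and t = 0])
       (auto simp: even intro!: Bochner_Integration.integral_cong split: split_indicator)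
  finally show ?thesis by (simp add: set_lebesgue_integral_def)
qed

text \<open>
  The one integral behind both transforms: with $z$ the width of the packet and $k$ imaginary it is
  the spherical transform, with $z$ the dual width shifted by $-it$ it is the evolution at time $t$.
\<close>

lemma set_integral_gaussian_sin_sin:
  fixes z k l :: complex
  assumes "Re z > 0"
  shows "(LINT x:{0<..}|lborel. exp (- z * (of_real x)\<^sup>2) * sin (k * x) * sin (l * x)) =
           sqrt pi / (4 * csqrt z) * (exp (- (k - l)\<^sup>2 / (4 * z)) - exp (- (k + l)\<^sup>2 / (4 * z)))"
proof -
  define J where "J w = sqrt pi / csqrt z * exp (w\<^sup>2 / (4 * z))" for w
  note G = has_bochner_integral_gaussian_complex[OF assms, folded J_def]
  have "exp (- z * (of_real x)\<^sup>2) * sin (k * x) * sin (l * x) =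
      (exp (- z * (of_real x)\<^sup>2 + (\<i> * (k - l)) * x) + exp (- z * (of_real x)\<^sup>2 + (- (\<i> * (k - l))) * x)
       - (exp (- z * (of_real x)\<^sup>2 + (\<i> * (k + l)) * x) + exp (- z * (of_real x)\<^sup>2 + (- (\<i> * (k + l))) * x))) / 4" for x :: real
  proof -
    have arg: "\<i> * (k * x - l * x) = \<i> * (k - l) * x" "\<i> * (k * x + l * x) = \<i> * (k + l) * x"
      by (simp_all add: algebra_simps)
    have "e * (((A + B) / 2 - (C + D) / 2) / 2) = (e * A + e * B - (e * C + e * D)) / 4" for e A B C D :: complex
      by (simp add: field_simps)
    then show ?thesis
      unfolding exp_add mult.assoc[of "exp _" "sin _"] sin_times_sin cos_exp_eq arg mult_minus_left .
  qed
  moreover have "has_bochner_integral lborel (\<lambda>x::real. 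
      (exp (- z * (of_real x)\<^sup>2 + (\<i> * (k - l)) * x) + exp (- z * (of_real x)\<^sup>2 + (- (\<i> * (k - l))) * x)
       - (exp (- z * (of_real x)\<^sup>2 + (\<i> * (k + l)) * x) + exp (- z * (of_real x)\<^sup>2 + (- (\<i> * (k + l))) * x))) / 4)
     ((J (\<i> * (k - l)) + J (- (\<i> * (k - l))) - (J (\<i> * (k + l)) + J (- (\<i> * (k + l))))) / 4)"
    by (intro has_bochner_integral_divide_zero has_bochner_integral_diff has_bochner_integral_add G)
  ultimately have "has_bochner_integral lborel (\<lambda>x::real. exp (- z * (of_real x)\<^sup>2) * sin (k * x) * sin (l * x))
     ((J (\<i> * (k - l)) + J (- (\<i> * (k - l))) - (J (\<i> * (k + l)) + J (- (\<i> * (k + l))))) / 4)"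
    by (simp only:)
  from set_integral_even[OF this]
  have "(LINT x:{0<..}|lborel. exp (- z * (of_real x)\<^sup>2) * sin (k * x) * sin (l * x)) =
      (J (\<i> * (k - l)) + J (- (\<i> * (k - l))) - (J (\<i> * (k + l)) + J (- (\<i> * (k + l))))) / 4 / 2"
    by simp
  moreover have "J (- (\<i> * v)) = sqrt pi / csqrt z * exp (- v\<^sup>2 / (4 * z))"
      "J (\<i> * v) = sqrt pi / csqrt z * exp (- v\<^sup>2 / (4 * z))" for v
    by (simp_all add: J_def power_mult_distrib)
  moreover have "(c * A + c * A - (c * B + c * B)) / 4 / 2 = c / 4 * (A - B)" for c A B :: complex
    by (simp add: field_simps)
  moreover have "sqrt pi / csqrt z / 4 = sqrt pi / (4 * csqrt z)"
    by (simp add: mult.commute)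
  ultimately show ?thesis by (simp only:)
qed

section \<open>Smooth functions of the squared norm\<close>

lemma Ck_on_cong:
  assumes "open S" "Ck_on k f S" "\<And>x. x \<in> S \<Longrightarrow> f x = g x"
  shows "Ck_on k g S"
  using assms(2,3)
proof (induction k arbitrary: f g)
  case 0
  then show ?case by (simp cong: continuous_on_cong)
next
  case (Suc k)
  have "(g has_derivative frechet_derivative f (at x)) (at x)" if "x \<in> S" for x
    using Suc.prems that assms(1)
    by (intro has_derivative_transform_within_open[of f _ x UNIV S g]) (auto simp: frechet_derivative_works)
  moreover from this have "frechet_derivative g (at x) = frechet_derivative f (at x)" if "x \<in> S" for x
    using that by (metis frechet_derivative_at)
  ultimately show ?case
    using Suc.prems Suc.IH[of "\<lambda>x. frechet_derivative f (at x) v" "\<lambda>x. frechet_derivative g (at x) v" for v]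
    by (auto simp: differentiable_def)
qed

text \<open>
  Smoothness by coinduction: any class of functions that is closed under directional derivatives
  consists of smooth functions.
\<close>

lemma smooth_on_coinduct:
  fixes f :: "'a::real_normed_vector \<Rightarrow> 'b::real_normed_vector"
  assumes "open S" "C f"
    and step: "\<And>h. C h \<Longrightarrow> \<exists>h'. (\<forall>x\<in>S. (h has_derivative h' x) (at x)) \<and> (\<forall>v. C (\<lambda>x. h' x v))"
  shows "smooth_on f S"
proof -
  have "Ck_on k h S" if "C h" for k h
    using that
  proof (induction k arbitrary: h)
    case 0
    then obtain h' where "\<forall>x\<in>S. (h has_derivative h' x) (at x)" using step by blast
    then show ?case
      by (auto intro!: continuous_at_imp_continuous_on dest: has_derivative_continuous)
  next
    case (Suc k)
    then obtain h' where h': "\<forall>x\<in>S. (h has_derivative h' x) (at x)" "\<forall>v. C (\<lambda>x. h' x v)"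
      using step by blast
    have "Ck_on k (\<lambda>x. frechet_derivative h (at x) v) S" for v
    proof (rule Ck_on_cong[OF assms(1) Suc.IH])
      show "C (\<lambda>x. h' x v)" using h'(2) by blast
      show "h' x v = frechet_derivative h (at x) v" if "x \<in> S" for x
        using frechet_derivative_at[OF h'(1)[rule_format, OF that]] by simp
    qed
    then show ?case using h'(1) by (auto simp: differentiable_def)
  qed
  then show ?thesis using assms(2) by (simp add: smooth_on_def)
qed

text \<open>
  An algebra of functions on the unit ball that contains the holomorphic functions of $|x|^2$ and is
  closed under directional derivatives: the derivative of $\Phi(|x|^2)$ in direction $v$ is
  $2 (x \cdot v)\, \Phi'(|x|^2)$, which is why the linear forms are included.
\<close>

inductive radial_analytic :: "('a::real_inner \<Rightarrow> complex) \<Rightarrow> bool" where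
  const: "radial_analytic (\<lambda>_. c)"
| inner: "radial_analytic (\<lambda>x. of_real (x \<bullet> e))"
| holo: "\<Phi> holomorphic_on ball 0 1 \<Longrightarrow> radial_analytic (\<lambda>x. \<Phi> (of_real (x \<bullet> x)))"
| add: "radial_analytic f \<Longrightarrow> radial_analytic g \<Longrightarrow> radial_analytic (\<lambda>x. f x + g x)"
| mult: "radial_analytic f \<Longrightarrow> radial_analytic g \<Longrightarrow> radial_analytic (\<lambda>x. f x * g x)"

lemma radial_analytic_derivative:
  fixes h :: "'a::real_inner \<Rightarrow> complex"
  assumes "radial_analytic h"
  shows "\<exists>h'. (\<forall>x\<in>ball 0 1. (h has_derivative h' x) (at x)) \<and> (\<forall>v::'a. radial_analytic (\<lambda>x. h' x v))"
  using assms
proof induction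
  case (const c)
  show ?case
    by (intro exI[of _ "\<lambda>_ _. 0"]) (auto intro: radial_analytic.const)
next
  case (inner e)
  have "((\<lambda>x. complex_of_real (x \<bullet> e)) has_derivative (\<lambda>v. of_real (v \<bullet> e))) (at x)" for x
    by (auto intro!: derivative_eq_intros)
  then show ?case
    by (intro exI[of _ "\<lambda>_ v. of_real (v \<bullet> e)"]) (auto intro: radial_analytic.const)
next
  case (holo \<Phi>)
  define h' where "h' = (\<lambda>(x::'a) v. deriv \<Phi> (of_real (x \<bullet> x)) * (2 * of_real (x \<bullet> v)))"
  have "((\<lambda>x. \<Phi> (of_real (x \<bullet> x))) has_derivative h' x) (at x)" if x: "x \<in> ball 0 1" for x :: 'a
  proof -
    have "x \<bullet> x < 1"
      using x abs_square_less_1[of "norm x"] by (simp add: power2_norm_eq_inner)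
    then have "(\<Phi> has_field_derivative deriv \<Phi> (of_real (x \<bullet> x))) (at (of_real (x \<bullet> x)))"
      using holo by (intro holomorphic_derivI[of _ "ball 0 1"]) auto
    moreover have "((\<lambda>x. complex_of_real (x \<bullet> x)) has_derivative (\<lambda>v. 2 * of_real (x \<bullet> v))) (at x)"
      by (auto intro!: derivative_eq_intros simp: inner_commute)
    ultimately show ?thesis
      unfolding h'_def by (rule has_derivative_compose[rotated, OF has_field_derivative_imp_has_derivative])
  qed
  moreover have "radial_analytic (\<lambda>x. h' x v)" for v
    unfolding h'_def using holo
    by (intro radial_analytic.mult radial_analytic.holo radial_analytic.const radial_analytic.inner holomorphic_deriv) auto
  ultimately show ?case by blast
next
  case (add f g)
  then obtain f' g' where "\<forall>x\<in>ball 0 1. (f has_derivative f' x) (at x)" "\<forall>v. radial_analytic (\<lambda>x. f' x v)"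
    "\<forall>x\<in>ball 0 1. (g has_derivative g' x) (at x)" "\<forall>v. radial_analytic (\<lambda>x. g' x v)" by blast
  then show ?case
    by (intro exI[of _ "\<lambda>x v. f' x v + g' x v"]) (auto intro!: has_derivative_add radial_analytic.add)
next
  case (mult f g)
  then obtain f' g' where "\<forall>x\<in>ball 0 1. (f has_derivative f' x) (at x)" "\<forall>v. radial_analytic (\<lambda>x. f' x v)"
    "\<forall>x\<in>ball 0 1. (g has_derivative g' x) (at x)" "\<forall>v. radial_analytic (\<lambda>x. g' x v)" by blast
  with mult show ?case
    by (intro exI[of _ "\<lambda>x v. f x * g' x v + f' x v * g x"])
       (auto intro!: has_derivative_mult radial_analytic.add radial_analytic.mult)
qed

text \<open>
  This turns the one-sided derivatives of a profile into complex derivatives, to which the Cauchy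
  estimates apply.
\<close>

lemma radial_deriv_entire:
  assumes H: "H holomorphic_on UNIV" and "s \<ge> 0"
  shows "radial_deriv m (\<lambda>s. H (of_real s)) s = (deriv ^^ m) H (of_real s)"
  using \<open>s \<ge> 0\<close>
proof (induction m arbitrary: s)
  case 0
  then show ?case by (simp add: radial_deriv_def)
next
  case (Suc m)
  let ?D = "(deriv ^^ m) H"
  have "?D holomorphic_on UNIV" using H by (simp add: holomorphic_higher_deriv)
  then have "(?D has_field_derivative deriv ?D (of_real s)) (at (of_real s))"
    using holomorphic_derivI by blast
  then have "((\<lambda>s. ?D (of_real s)) has_vector_derivative deriv ?D (of_real s)) (at s within {0..})"
    using has_vector_derivative_real_field has_vector_derivative_at_within by blast
  then have "(radial_deriv m (\<lambda>s. H (of_real s)) has_vector_derivative deriv ?D (of_real s)) (at s within {0..})"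
    using Suc.prems Suc.IH by (elim has_vector_derivative_transform[rotated 2]) auto
  moreover have "at s within {0..} \<noteq> bot"
  proof -
    have "{0..} \<noteq> {x}" for x :: real
      by (metis atLeast_iff order_refl singletonD zero_le_one zero_neq_one)
    then show ?thesis
      using Suc.prems connected_imp_perfect[of "{0::real..}" s] by (simp add: trivial_limit_within)
  qed
  ultimately show ?case
    unfolding radial_deriv_def by (simp add: vector_derivative_within)
qed

section \<open>Wave packets with entire profile\<close>

text \<open>
  Chebyshev polynomials of the second kind, with the index shifted by one: \<open>cheb n\<close> is $U_{n-1}$.
\<close>

fun cheb :: "nat \<Rightarrow> 'a::comm_ring_1 \<Rightarrow> 'a" where
  "cheb 0 x = 0"
| "cheb (Suc 0) x = 1"
| "cheb (Suc (Suc n)) x = 2 * x * cheb (Suc n) x - cheb n x"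

text \<open>
  The reason for these polynomials: $\sinh(ns)/\sinh s$ is a polynomial in $\cosh s$, so multiplying
  by $\sinh s$ leaves a bare hyperbolic sine and no singularity has to be removed at $0$.
\<close>

lemma cheb_cosh_times_sinh:
  fixes z :: "'a::{banach, real_normed_field}"
  shows "cheb n (cosh z) * sinh z = sinh (of_nat n * z)"
proof (induction n "cosh z" rule: cheb.induct)
  case (3 n)
  define w where "w = of_nat (Suc n) * z"
  have w: "of_nat (Suc (Suc n)) * z = w + z" "of_nat n * z = w - z"
    by (simp_all add: w_def algebra_simps)
  have "cheb (Suc (Suc n)) (cosh z) * sinh z =
      2 * cosh z * (cheb (Suc n) (cosh z) * sinh z) - cheb n (cosh z) * sinh z"
    by (simp add: algebra_simps)
  also have "\<dots> = 2 * cosh z * sinh w - sinh (w - z)"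
    using 3 by (simp add: w_def algebra_simps)
  also have "\<dots> = sinh (w + z)"
    by (simp add: sinh_add sinh_diff algebra_simps)
  finally show ?case by (simp only: w)
qed auto

lemma cheb_holomorphic [holomorphic_intros]:
  "g holomorphic_on S \<Longrightarrow> (\<lambda>z. cheb n (g z)) holomorphic_on S"
  by (induction n rule: induct_nat_012) (auto intro!: holomorphic_intros)

lemma norm_cheb_cosh_le:
  fixes z :: complex
  shows "norm (cheb n (cosh z)) \<le> (3 * exp \<bar>Re z\<bar>) ^ n"
proof (induction n "cosh z" rule: cheb.induct)
  case 2
  have "1 \<le> exp \<bar>Re z\<bar>" by simp
  then have "1 \<le> 3 * exp \<bar>Re z\<bar>" by linarith
  then show ?case by simp
next
  case (3 n)
  define e where "e = exp \<bar>Re z\<bar>"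
  have e: "e \<ge> 1" by (simp add: e_def)
  have "norm (exp z) \<le> e" "norm (exp (- z)) \<le> e" by (auto simp: e_def norm_exp_eq_Re)
  then have "norm (exp z + exp (- z)) \<le> e + e"
    using norm_triangle_mono by blast
  then have ch: "norm (cosh z) \<le> e" by (simp add: cosh_field_def norm_divide)
  have "norm (cheb (Suc (Suc n)) (cosh z)) \<le> 2 * norm (cosh z) * norm (cheb (Suc n) (cosh z)) + norm (cheb n (cosh z))"
    by (simp add: order.trans[OF norm_triangle_ineq4] norm_mult)
  also have "\<dots> \<le> 2 * e * (3 * e) ^ Suc n + (3 * e) ^ n"
    using 3 ch e by (intro add_mono mult_mono) (auto simp: e_def)
  also have "\<dots> = (6 * e\<^sup>2 + 1) * (3 * e) ^ n"
    by (simp add: algebra_simps power2_eq_square)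
  finally have 1: "norm (cheb (Suc (Suc n)) (cosh z)) \<le> (6 * e\<^sup>2 + 1) * (3 * e) ^ n" .
  have "1 \<le> e\<^sup>2" using e by (simp add: one_le_power)
  then have "(6 * e\<^sup>2 + 1) * (3 * e) ^ n \<le> (9 * e\<^sup>2) * (3 * e) ^ n"
    using e by (intro mult_right_mono) (linarith, simp)
  also have "(9 * e\<^sup>2) * (3 * e) ^ n = (3 * e) ^ Suc (Suc n)" by (simp add: power2_eq_square)
  finally show ?case using 1 by (simp only: e_def)
qed auto

text \<open>
  With $a = n(1 - i)/8$, the function $e^{-a s^2} e^{ns}$ is a wave packet centred at
  $s = n / (2\,\mathrm{Re}\, a) = 4$ with spatial width of order $n^{-1/2}$. The imaginary part of
  $a$ gives it the local frequency $-2\,(\mathrm{Im}\, a)\, s = n$ there, up to an error of order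
  $n^{1/2}$.
\<close>

definition packet_width :: "nat \<Rightarrow> complex" where
  "packet_width n = of_nat n * (1 - \<i>) / 8"

definition packet :: "nat \<Rightarrow> complex \<Rightarrow> complex" where
  "packet n z = exp (- packet_width n * z\<^sup>2) * cheb n (cosh z)"

lemma packet_holomorphic: "packet n holomorphic_on UNIV"
proof -
  have "(\<lambda>z. exp (- packet_width n * z\<^sup>2) * cheb n ((exp z + exp (- z)) / 2)) holomorphic_on UNIV"
    by (intro holomorphic_intros) auto
  then show ?thesis by (simp add: packet_def[abs_def] cosh_field_def)
qed

text \<open>
  A Gaussian bound on the strip $|\mathrm{Im}\, z| \le 1$, which contains the unit circles around all
  real points; the polynomial grows only like $(3 e^{|\mathrm{Re}\, z|})^n$, which the Gaussian outweighs.
\<close>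

lemma norm_packet_le:
  assumes "\<bar>Im z\<bar> \<le> 1"
  shows "norm (packet n z) \<le> exp (n * (3 + 2 * \<bar>Re z\<bar> - \<bar>Re z\<bar>\<^sup>2 / 8))"
proof -
  have "Re (- packet_width n * z\<^sup>2) = - (n * ((Re z)\<^sup>2 - (Im z)\<^sup>2 + 2 * Re z * Im z) / 8)"
    by (simp add: packet_width_def power2_eq_square algebra_simps)
  also have "\<dots> \<le> n * (1 + 2 * \<bar>Re z\<bar> - \<bar>Re z\<bar>\<^sup>2) / 8"
  proof -
    have "\<bar>Re z * Im z\<bar> \<le> \<bar>Re z\<bar> * 1" unfolding abs_mult using assms by (intro mult_left_mono) auto
    moreover have "(Im z)\<^sup>2 \<le> 1" using assms by (simp add: abs_square_le_1)
    ultimately have "real n * (- ((Re z)\<^sup>2 - (Im z)\<^sup>2 + 2 * Re z * Im z)) \<le> n * (1 + 2 * \<bar>Re z\<bar> - \<bar>Re z\<bar>\<^sup>2)"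
      by (intro mult_left_mono) (auto simp: abs_le_iff)
    moreover have "- (a * X / 8) \<le> a * Y / 8" if "a * (- X) \<le> a * Y" for a X Y :: real
      using that by simp
    ultimately show ?thesis by blast
  qed
  finally have "norm (exp (- packet_width n * z\<^sup>2)) \<le> exp (n * (1 + 2 * \<bar>Re z\<bar> - \<bar>Re z\<bar>\<^sup>2) / 8)"
    by (simp add: norm_exp_eq_Re)
  moreover have "norm (cheb n (cosh z)) \<le> exp (n * (2 + \<bar>Re z\<bar>))"
  proof -
    have "3 * exp \<bar>Re z\<bar> \<le> exp 2 * exp \<bar>Re z\<bar>"
      using exp_ge_add_one_self[of "2::real"] by (intro mult_right_mono) auto
    then have "(3 * exp \<bar>Re z\<bar>) ^ n \<le> exp (2 + \<bar>Re z\<bar>) ^ n"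
      unfolding exp_add by (intro power_mono) auto
    then show ?thesis
      using norm_cheb_cosh_le[of n z] by (simp add: exp_of_nat_mult)
  qed
  ultimately have "norm (packet n z) \<le> exp (n * (1 + 2 * \<bar>Re z\<bar> - \<bar>Re z\<bar>\<^sup>2) / 8) * exp (n * (2 + \<bar>Re z\<bar>))"
    unfolding packet_def norm_mult by (intro mult_mono) auto
  also have "\<dots> = exp (n * ((1 + 2 * \<bar>Re z\<bar> - \<bar>Re z\<bar>\<^sup>2) / 8 + (2 + \<bar>Re z\<bar>)))"
    unfolding mult_exp_exp by (simp add: distrib_left)
  also have "\<dots> \<le> exp (n * (3 + 2 * \<bar>Re z\<bar> - \<bar>Re z\<bar>\<^sup>2 / 8))"
    by (subst exp_le_cancel_iff, intro mult_left_mono) (auto simp: field_simps)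
  finally show ?thesis .
qed

text \<open>
  The Cauchy estimate on the unit circle around $s$ carries the Gaussian decay over to every
  derivative, and $(1 + s)^k e^s \le e^{(k+1)s}$ absorbs the weight.
\<close>

lemma packet_decay:
  assumes "n > 0"
  shows "bdd_above ((\<lambda>s. (1 + s) ^ k * exp s * norm (radial_deriv m (\<lambda>s. packet n (of_real s)) s)) ` {0..})"
proof (rule bdd_aboveI2)
  fix s :: real assume "s \<in> {0..}"
  then have s: "s \<ge> 0" by simp
  \<comment> \<open>With \<open>y = \<bar>Re z\<bar>\<close> the exponent is at most \<open>K * y - y\<^sup>2 / 8\<close> plus constants, and the
    maximum of that quadratic is \<open>2 * K\<^sup>2\<close>.\<close>
  define K where "K = 2 * real n + real (Suc k)"
  define B where "B = exp (3 * real n + 2 * K\<^sup>2 + Suc k)"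
  have sph: "norm (packet n z) \<le> B * exp (- (Suc k * s))" if z: "norm (of_real s - z) = 1" for z
  proof -
    define y where "y = \<bar>Re z\<bar>"
    have "\<bar>Im z\<bar> \<le> 1" using abs_Im_le_cmod[of "of_real s - z"] z by simp
    moreover have "s \<le> y + 1" using abs_Re_le_cmod[of "of_real s - z"] z by (simp add: y_def)
    then have "Suc k * s \<le> Suc k * (y + 1)" by (intro mult_left_mono) auto
    moreover have "n * (3 + 2 * y - y\<^sup>2 / 8) \<le> n * (3 + 2 * y) - y\<^sup>2 / 8"
      using assms mult_right_mono[of 1 "real n" "y\<^sup>2 / 8"] by (simp add: algebra_simps)
    moreover have "K * y - y\<^sup>2 / 8 \<le> 2 * K\<^sup>2"
      using zero_le_power2[of "y - 4 * K"] by (simp add: power2_diff power_mult_distrib) (simp add: algebra_simps)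
    ultimately have "n * (3 + 2 * y - y\<^sup>2 / 8) \<le> 3 * real n + 2 * K\<^sup>2 + Suc k + - (Suc k * s)" "\<bar>Im z\<bar> \<le> 1"
      by (simp_all add: K_def algebra_simps)
    then show ?thesis
      unfolding B_def exp_add[symmetric] using norm_packet_le[of z n] by (auto simp: y_def elim: order.trans)
  qed
  have "norm ((deriv ^^ m) (packet n) (of_real s)) \<le> fact m * (B * exp (- (Suc k * s))) / 1 ^ m"
    by (rule Cauchy_inequality[OF _ _ _ sph])
       (auto intro: holomorphic_on_subset[OF packet_holomorphic] holomorphic_on_imp_continuous_on)
  then have "norm (radial_deriv m (\<lambda>s. packet n (of_real s)) s) \<le> fact m * (B * exp (- (Suc k * s)))"
    using radial_deriv_entire[OF packet_holomorphic s] by simp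
  moreover have "(1 + s) ^ k * exp s \<le> exp (Suc k * s)"
    using power_mono[of "1 + s" "exp s" k] s exp_ge_add_one_self[of s]
    by (simp add: exp_add ring_distribs exp_of_nat_mult)
  ultimately have "(1 + s) ^ k * exp s * norm (radial_deriv m (\<lambda>s. packet n (of_real s)) s)
      \<le> exp (Suc k * s) * (fact m * (B * exp (- (Suc k * s))))"
    using s by (intro mult_mono) auto
  also have "\<dots> = fact m * B * (exp (Suc k * s) * exp (- (Suc k * s)))"
    by (simp only: mult_ac)
  also have "\<dots> = fact m * B"
    by (simp only: exp_minus_inverse mult_1_right)
  finally show "(1 + s) ^ k * exp s * norm (radial_deriv m (\<lambda>s. packet n (of_real s)) s) \<le> fact m * B" .
qed

section \<open>Smoothness of the packets on hyperbolic space\<close>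

text \<open>
  The function $P(v) = \mathrm{artanh}(\sqrt v) / \sqrt v = \sum_k v^k / (2k + 1)$. It shows that the
  square of the geodesic distance $s = 2\,\mathrm{artanh}\, r$ is the analytic function $4 v P(v)^2$
  of $v = r^2$, although $s$ itself is not differentiable at the origin.
\<close>

lemma artanh_quotient_series:
  obtains P :: "complex \<Rightarrow> complex" where "P holomorphic_on ball 0 1"
    "\<And>r. 0 \<le> r \<Longrightarrow> r < 1 \<Longrightarrow> of_real (ln ((1 + r) / (1 - r))) = 2 * of_real r * P (of_real (r\<^sup>2))"
proof
  define c :: "nat \<Rightarrow> complex" where "c k = 1 / of_nat (2 * k + 1)" for k
  define P where "P = (\<lambda>z. \<Sum>k. c k * z ^ k)"
  have sums: "(\<lambda>k. c k * z ^ k) sums P z" if "z \<in> ball 0 1" for z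
  proof -
    have "norm (c k * z ^ k) \<le> norm z ^ k" for k
      unfolding c_def norm_mult norm_divide norm_power by (intro mult_left_le_one_le) (auto simp: norm_of_nat simp del: of_nat_add of_nat_mult of_nat_Suc)
    then have "summable (\<lambda>k. c k * z ^ k)"
      using that by (intro summable_comparison_test[OF _ summable_geometric[of "norm z"]]) auto
    then show ?thesis by (simp add: P_def summable_sums)
  qed
  then show "P holomorphic_on ball 0 1"
    by (intro power_series_holomorphic[of 0 1 c]) simp
  fix r :: real assume r: "0 \<le> r" "r < 1"
  have "((1 + r) / (1 - r) - 1) / ((1 + r) / (1 - r) + 1) = r"
    using r by (simp add: field_simps)
  then have "(\<lambda>k. 2 * r ^ (2 * k + 1) / of_nat (2 * k + 1)) sums ln ((1 + r) / (1 - r))"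
    using ln_series_quadratic[of "(1 + r) / (1 - r)"] r by simp
  from sums_of_real[OF this, where ?'a = complex]
  have "(\<lambda>k. complex_of_real (2 * r ^ (2 * k + 1) / of_nat (2 * k + 1))) sums of_real (ln ((1 + r) / (1 - r)))" .
  moreover have "complex_of_real (2 * r ^ (2 * k + 1) / of_nat (2 * k + 1)) = 2 * of_real r * (c k * of_real (r\<^sup>2) ^ k)" for k
    by (simp add: c_def power_mult)
  ultimately have "(\<lambda>k. 2 * of_real r * (c k * of_real (r\<^sup>2) ^ k)) sums of_real (ln ((1 + r) / (1 - r)))"
    by (simp only:)
  moreover have "(\<lambda>k. 2 * of_real r * (c k * of_real (r\<^sup>2) ^ k)) sums (2 * of_real r * P (of_real (r\<^sup>2)))"
    using r by (intro sums_mult sums) (auto simp: norm_power power_less_one_iff abs_square_less_1 simp flip: of_real_power)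
  ultimately show "of_real (ln ((1 + r) / (1 - r))) = 2 * of_real r * P (of_real (r\<^sup>2))"
    by (rule sums_unique2)
qed

lemma hyp_dist_origin:
  assumes "norm x < 1"
  defines "r \<equiv> norm x"
  shows "hyp_dist hyp_origin x = ln ((1 + r) / (1 - r))"
    and "cosh (ln ((1 + r) / (1 - r))) = (1 + r\<^sup>2) / (1 - r\<^sup>2)"
proof -
  have r: "0 \<le> r" "r < 1" using assms by auto
  then have r2: "r\<^sup>2 < 1" by (simp add: abs_square_less_1)
  have pos: "(1 + r) / (1 - r) > 0" using r by simp
  have "((1 + r) / (1 - r) + inverse ((1 + r) / (1 - r))) / 2 = (1 + r\<^sup>2) / (1 - r\<^sup>2)"
    using r r2 by (simp add: divide_simps) (simp add: power2_eq_square algebra_simps)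
  with cosh_ln_real[OF pos]
  show *: "cosh (ln ((1 + r) / (1 - r))) = (1 + r\<^sup>2) / (1 - r\<^sup>2)"
    by (simp only:)
  have "hyp_dist hyp_origin x = arcosh (1 + 2 * r\<^sup>2 / (1 - r\<^sup>2))"
    by (simp add: hyp_dist_def hyp_origin_def r_def)
  also have "1 + 2 * r\<^sup>2 / (1 - r\<^sup>2) = cosh (ln ((1 + r) / (1 - r)))"
    unfolding * using r2 by (simp add: field_simps)
  also have "arcosh \<dots> = ln ((1 + r) / (1 - r))"
    using r by (intro arcosh_cosh_real) (simp add: field_simps)
  finally show "hyp_dist hyp_origin x = ln ((1 + r) / (1 - r))" .
qed

text \<open>
  Both ingredients of the packet are analytic in $v = |x|^2$: the square of the distance by the
  series above, and $\cosh s = (1 + v)/(1 - v)$.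
\<close>

lemma packet_smooth: "smooth_on (\<lambda>x. packet n (of_real (hyp_dist hyp_origin x))) hyp3"
proof -
  obtain P :: "complex \<Rightarrow> complex" where P: "P holomorphic_on ball 0 1"
    "\<And>r. 0 \<le> r \<Longrightarrow> r < 1 \<Longrightarrow> of_real (ln ((1 + r) / (1 - r))) = 2 * of_real r * P (of_real (r\<^sup>2))"
    by (rule artanh_quotient_series, rule that)
  define \<Phi> where "\<Phi> = (\<lambda>z. exp (- packet_width n * (4 * z * (P z)\<^sup>2)) * cheb n ((1 + z) / (1 - z)))"
  have "\<Phi> holomorphic_on ball 0 1"
    unfolding \<Phi>_def by (intro holomorphic_intros P(1)) auto
  then have smooth: "smooth_on (\<lambda>x::real^3. \<Phi> (of_real (x \<bullet> x))) (ball 0 1)"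
    by (intro smooth_on_coinduct[of _ radial_analytic] radial_analytic_derivative radial_analytic.holo) auto
  have eq: "\<Phi> (of_real (x \<bullet> x)) = packet n (of_real (hyp_dist hyp_origin x))" if "x \<in> ball 0 1" for x :: "real^3"
  proof -
    define r where "r = norm x"
    define s where "s = ln ((1 + r) / (1 - r))"
    have r: "0 \<le> r" "r < 1" using that by (auto simp: r_def)
    have dist: "hyp_dist hyp_origin x = s" and cosh: "cosh s = (1 + r\<^sup>2) / (1 - r\<^sup>2)"
      using hyp_dist_origin[of x] r unfolding r_def s_def by blast+
    have "cosh (complex_of_real s) = of_real (cosh s)"
      by (simp add: cosh_field_def exp_of_real flip: of_real_minus)
    then have cosh': "cosh (complex_of_real s) = (1 + of_real (r\<^sup>2)) / (1 - of_real (r\<^sup>2))"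
      unfolding cosh by simp
    have sq: "(of_real s)\<^sup>2 = 4 * of_real (r\<^sup>2) * (P (of_real (r\<^sup>2)))\<^sup>2"
      unfolding s_def P(2)[OF r] by (simp add: power_mult_distrib)
    have "x \<bullet> x = r\<^sup>2" by (simp add: r_def power2_norm_eq_inner)
    then show ?thesis
      unfolding packet_def \<Phi>_def dist cosh' sq by (simp only:)
  qed
  show ?thesis
    unfolding smooth_on_def hyp3_def
  proof
    fix k
    have "Ck_on k (\<lambda>x::real^3. \<Phi> (of_real (x \<bullet> x))) (ball 0 1)"
      using smooth unfolding smooth_on_def by (rule spec)
    from Ck_on_cong[OF open_ball this eq]
    show "Ck_on k (\<lambda>x. packet n (of_real (hyp_dist hyp_origin x))) (ball 0 1)" .
  qed
qed

lemma packet_schwartz: "n > 0 \<Longrightarrow> radial_L2_schwartz (\<lambda>s. packet n (of_real s))"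
  unfolding radial_L2_schwartz_def by (intro conjI allI packet_smooth packet_decay)

section \<open>Transform and evolution of the packets\<close>

text \<open>
  The width of the packet on the frequency side: the transform of $e^{-a s^2}$ is a multiple of
  $e^{-\gamma \nu^2}$ with $\gamma = 1/(4a)$.
\<close>

definition packet_dual :: "nat \<Rightarrow> complex" where
  "packet_dual n = (1 + \<i>) / of_nat n"

definition packet_amp :: "nat \<Rightarrow> complex" where
  "packet_amp n = sqrt pi / (2 * csqrt (packet_width n))"

lemma packet_dual_width: "n > 0 \<Longrightarrow> 4 * packet_width n * packet_dual n = 1"
  by (simp add: packet_width_def packet_dual_def field_simps)

lemma norm_packet_width: "norm (packet_width n) = sqrt 2 * n / 8"
proof -
  have "norm (1 - \<i>) = sqrt 2" by (simp add: cmod_def)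
  then show ?thesis by (simp add: packet_width_def norm_mult norm_divide)
qed

lemma norm_packet_amp_squared: "n > 0 \<Longrightarrow> (norm (packet_amp n))\<^sup>2 = sqrt 2 * pi / n"
  by (simp add: packet_amp_def norm_divide norm_mult norm_packet_width power_divide power_mult_distrib real_sqrt_mult field_simps)

lemma packet_times_sinh: "packet n z * sinh z = - \<i> * (exp (- packet_width n * z\<^sup>2) * sin (\<i> * of_nat n * z))"
proof -
  have "packet n z * sinh z = exp (- packet_width n * z\<^sup>2) * (cheb n (cosh z) * sinh z)"
    by (simp add: packet_def)
  also have "\<dots> = exp (- packet_width n * z\<^sup>2) * sinh (of_nat n * z)"
    by (simp only: cheb_cosh_times_sinh)
  also have "sinh (of_nat n * z) = - \<i> * sin (\<i> * of_nat n * z)"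
    by (simp add: sin_conv_sinh mult.assoc[symmetric])
  finally show ?thesis by (simp only: mult_ac)
qed

text \<open>
  Since $f(s) \sinh s = e^{-a s^2} \sinh(ns)$, the spherical transform is a sine transform of a
  Gaussian with an imaginary shift.
\<close>

lemma spherical_transform_packet:
  assumes n: "n > 0" and \<nu>: "\<nu> > 0"
  shows "spherical_transform (\<lambda>s. packet n (of_real s)) \<nu> =
    packet_amp n * exp (packet_dual n * ((of_nat n)\<^sup>2 - (of_real \<nu>)\<^sup>2)) * sin (2 * packet_dual n * of_nat n * \<nu>) / \<nu>"
proof -
  define a where "a = packet_width n"
  define \<gamma> where "\<gamma> = packet_dual n"
  have Re_a: "Re a > 0" using n by (simp add: a_def packet_width_def)
  have a0: "a \<noteq> 0" using Re_a by auto
  have quot: "w / (4 * a) = \<gamma> * w" for w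
    using packet_dual_width[OF n] a0 by (simp add: a_def \<gamma>_def field_simps)
  have "spherical_transform (\<lambda>s. packet n (of_real s)) \<nu> =
     (LINT s:{0<..}|lborel. (- \<i> / \<nu>) * (exp (- a * (of_real s)\<^sup>2) * sin (\<i> * of_nat n * s) * sin (complex_of_real \<nu> * complex_of_real s)))"
    unfolding spherical_transform_def
  proof (rule set_lebesgue_integral_cong, simp, intro allI impI)
    fix s :: real assume "s \<in> {0<..}"
    then have s: "s > 0" by simp
    have "spherical_fun \<nu> s * (sinh s)\<^sup>2 = sinh s * sin (\<nu> * s) / \<nu>"
      using s by (simp add: spherical_fun_def power2_eq_square)
    then have "packet n (of_real s) * of_real (spherical_fun \<nu> s * (sinh s)\<^sup>2) =
      (packet n (of_real s) * sinh (of_real s)) * sin (\<nu> * s) / \<nu>"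
      by (simp add: sinh_field_def exp_of_real sin_of_real flip: of_real_minus)
    then show "packet n (of_real s) * of_real (spherical_fun \<nu> s * (sinh s)\<^sup>2) =
      (- \<i> / \<nu>) * (exp (- a * (of_real s)\<^sup>2) * sin (\<i> * of_nat n * s) * sin (complex_of_real \<nu> * complex_of_real s))"
      unfolding packet_times_sinh a_def of_real_mult[symmetric] sin_of_real by simp
  qed
  also have "\<dots> = (- \<i> / \<nu>) * (sqrt pi / (4 * csqrt a) *
      (exp (- (\<i> * of_nat n - \<nu>)\<^sup>2 / (4 * a)) - exp (- (\<i> * of_nat n + \<nu>)\<^sup>2 / (4 * a))))"
    by (simp only: set_integral_mult_right set_integral_gaussian_sin_sin[OF Re_a])
  also have "- (\<i> * of_nat n - \<nu>)\<^sup>2 / (4 * a) = \<gamma> * ((of_nat n)\<^sup>2 - (of_real \<nu>)\<^sup>2) + \<i> * (2 * \<gamma> * of_nat n * \<nu>)"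
    unfolding quot by (simp add: power2_diff power_mult_distrib algebra_simps)
  also have "- (\<i> * of_nat n + \<nu>)\<^sup>2 / (4 * a) = \<gamma> * ((of_nat n)\<^sup>2 - (of_real \<nu>)\<^sup>2) + - (\<i> * (2 * \<gamma> * of_nat n * \<nu>))"
    unfolding quot by (simp add: power2_sum power_mult_distrib algebra_simps)
  also have "(- \<i> / \<nu>) * (sqrt pi / (4 * csqrt a) * (exp (u + \<i> * v) - exp (u + - (\<i> * v)))) =
     packet_amp n * exp u * sin v / \<nu>" for u v
    unfolding packet_amp_def a_def[symmetric] exp_add sin_exp_eq using \<nu> a0 by (simp add: field_simps)
  finally show ?thesis by (simp only: \<gamma>_def)
qed

text \<open>
  After the factors $\nu$ cancel, the evolution integrates
  $e^{-(\gamma - it)\nu^2} \sin(s\nu) \sin(2\gamma n \nu)$: time only shifts the width, and the result is a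
  difference of two Gaussians, one for each of two packets that are mirror images under
  $s \mapsto -s$.
\<close>

lemma schroedinger_packet:
  fixes s t :: real and z k :: complex
  assumes n: "n > 0" and s: "s > 0"
  defines "z \<equiv> packet_dual n - \<i> * of_real t"
    and "k \<equiv> 2 * packet_dual n * of_nat n"
  shows "schroedinger t (\<lambda>s. packet n (of_real s)) s =
    (exp (\<i> * t) * packet_amp n * exp (packet_dual n * (of_nat n)\<^sup>2) / sinh s) *
    (sqrt pi / (4 * csqrt z) * (exp (- (s - k)\<^sup>2 / (4 * z)) - exp (- (s + k)\<^sup>2 / (4 * z))))"
proof -
  have z: "Re z > 0" using n by (simp add: z_def packet_dual_def)
  let ?c = "exp (\<i> * t) * packet_amp n * exp (packet_dual n * (of_nat n)\<^sup>2) / sinh s"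
  have "schroedinger t (\<lambda>s. packet n (of_real s)) s =
     (LINT \<nu>:{0<..}|lborel. ?c * (exp (- z * (of_real \<nu>)\<^sup>2) * sin (complex_of_real s * complex_of_real \<nu>) * sin (k * \<nu>)))"
    unfolding schroedinger_def
  proof (rule set_lebesgue_integral_cong, simp, intro allI impI)
    fix \<nu> :: real assume "\<nu> \<in> {0<..}"
    then have \<nu>: "\<nu> > 0" by simp
    have e: "exp (\<i> * of_real (t * (\<nu>\<^sup>2 + 1))) * exp (packet_dual n * ((of_nat n)\<^sup>2 - (of_real \<nu>)\<^sup>2))
        = exp (\<i> * t) * exp (packet_dual n * (of_nat n)\<^sup>2) * exp (- z * (of_real \<nu>)\<^sup>2)"
      unfolding mult_exp_exp by (simp add: z_def algebra_simps)
    have "of_real (spherical_fun \<nu> s) * exp (\<i> * of_real (t * (\<nu>\<^sup>2 + 1))) *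
        spherical_transform (\<lambda>s. packet n (of_real s)) \<nu> * of_real (\<nu>\<^sup>2) =
       (complex_of_real (spherical_fun \<nu> s) * complex_of_real \<nu>) * packet_amp n * sin (k * \<nu>) *
        (exp (\<i> * of_real (t * (\<nu>\<^sup>2 + 1))) * exp (packet_dual n * ((of_nat n)\<^sup>2 - (of_real \<nu>)\<^sup>2)))"
      unfolding spherical_transform_packet[OF n \<nu>] k_def[symmetric]
      using \<nu> by (simp add: power2_eq_square mult_ac)
    also have "complex_of_real (spherical_fun \<nu> s) * complex_of_real \<nu> = sin (complex_of_real s * complex_of_real \<nu>) / complex_of_real (sinh s)"
      unfolding of_real_mult[symmetric] sin_of_real of_real_divide[symmetric]
      using s \<nu> by (simp add: spherical_fun_def mult.commute)
    finally show "of_real (spherical_fun \<nu> s) * exp (\<i> * of_real (t * (\<nu>\<^sup>2 + 1))) *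
        spherical_transform (\<lambda>s. packet n (of_real s)) \<nu> * of_real (\<nu>\<^sup>2) =
        ?c * (exp (- z * (of_real \<nu>)\<^sup>2) * sin (complex_of_real s * complex_of_real \<nu>) * sin (k * \<nu>))"
      unfolding e by (simp add: mult_ac)
  qed
  then show ?thesis
    by (simp only: set_integral_mult_right set_integral_gaussian_sin_sin[OF z])
qed

section \<open>The maximal function of the packets\<close>

text \<open>
  The packet starts at $s = 4$ and moves towards the origin with speed $2n$, so it sits over the point
  $s = 2 + 2\theta$ at time $t = (1 - \theta)/n$. With $\zeta = 1 + i\theta$ the parameter
  $\gamma - it$ at that time is $\zeta / n$ and the first Gaussian is exactly $e^{n \zeta}$.
  Spreading up to this time changes the amplitude only by a bounded factor, and the Gaussian of the
  reflected packet is at most $1$.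
\<close>

lemma norm_schroedinger_packet_ge:
  assumes n: "n > 0" and \<theta>: "0 < \<theta>" "\<theta> < 1"
  defines "s \<equiv> 2 + 2 * \<theta>" and "t \<equiv> (1 - \<theta>) / n"
  shows "pi / 4 * exp (real n) * (exp (real n) - 1) / sinh s \<le> norm (schroedinger t (\<lambda>s. packet n (of_real s)) s)"
proof -
  define z where "z = packet_dual n - \<i> * of_real t"
  define k :: complex where "k = 2 + 2 * \<i>"
  define \<zeta> where "\<zeta> = 1 + \<i> * complex_of_real \<theta>"
  have s: "s > 0" using \<theta> by (simp add: s_def)
  have k: "2 * packet_dual n * of_nat n = k" using n by (simp add: packet_dual_def k_def)
  have z: "z = \<zeta> / n" by (simp add: z_def packet_dual_def t_def \<zeta>_def algebra_simps flip: add_divide_distrib diff_divide_distrib)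
  have \<zeta>0: "\<zeta> \<noteq> 0" by (simp add: \<zeta>_def complex_eq_iff)
  have "(s - k)\<^sup>2 = - 4 * \<zeta>\<^sup>2"
    by (simp add: s_def k_def \<zeta>_def complex_eq_iff power2_eq_square algebra_simps)
  then have "- (s - k)\<^sup>2 / (4 * z) = \<zeta>\<^sup>2 / z" by simp
  also have "\<dots> = n * \<zeta>"
    using n \<zeta>0 by (simp add: z power2_eq_square)
  finally have "- (s - k)\<^sup>2 / (4 * z) = n * \<zeta>" .
  then have E1: "norm (exp (- (s - k)\<^sup>2 / (4 * z))) = exp (real n)"
    by (simp add: norm_exp_eq_Re \<zeta>_def)
  have "Re (- (s + k)\<^sup>2 / (4 * z)) \<le> 0"
  proof -
    have "(s + k)\<^sup>2 = 4 * (2 + \<theta> + \<i>)\<^sup>2"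
      by (simp add: s_def k_def complex_eq_iff power2_eq_square algebra_simps)
    then have "(s + k)\<^sup>2 / (4 * z) = of_real n * ((2 + \<theta> + \<i>)\<^sup>2 / \<zeta>)"
      using n by (simp add: z)
    then have "Re (- (s + k)\<^sup>2 / (4 * z)) = - (n * Re ((2 + \<theta> + \<i>)\<^sup>2 / \<zeta>))"
      unfolding minus_divide_left[symmetric] by (simp only: uminus_complex.simps Re_complex_of_real Im_complex_of_real times_complex.simps)
    moreover have "Re ((2 + \<theta> + \<i>)\<^sup>2 / \<zeta>) \<ge> 0"
    proof -
      have "Re ((2 + \<theta> + \<i>)\<^sup>2 * cnj \<zeta>) = (2 + \<theta>)\<^sup>2 - 1 + 2 * \<theta> * (2 + \<theta>)"
        by (simp add: \<zeta>_def power2_eq_square algebra_simps)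
      also have "\<dots> \<ge> 0" using \<theta> by (simp add: power2_eq_square algebra_simps)
      finally show ?thesis
        by (subst complex_div_cnj) (simp add: Re_divide_of_real flip: of_real_power)
    qed
    ultimately show ?thesis by simp
  qed
  then have E2: "norm (exp (- (s + k)\<^sup>2 / (4 * z))) \<le> 1"
    unfolding norm_exp_eq_Re by simp
  have "exp (real n) - 1 \<le> norm (exp (- (s - k)\<^sup>2 / (4 * z)) - exp (- (s + k)\<^sup>2 / (4 * z)))"
    using norm_triangle_ineq2[of "exp (- (s - k)\<^sup>2 / (4 * z))" "exp (- (s + k)\<^sup>2 / (4 * z))"] E1 E2 by linarith
  moreover have "pi / 4 \<le> norm (packet_amp n * (sqrt pi / (4 * csqrt z)))"
  proof -
    define q where "q = norm (packet_width n) * norm z"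
    have "q \<le> (1 / 2)\<^sup>2"
    proof -
      have "\<theta>\<^sup>2 \<le> 1" using \<theta> by (simp add: abs_square_le_1)
      then have "norm \<zeta> \<le> sqrt 2" by (simp add: \<zeta>_def cmod_def)
      then have "sqrt 2 * norm \<zeta> \<le> sqrt 2 * sqrt 2" by (intro mult_left_mono) auto
      then show ?thesis
        using n by (simp add: q_def norm_packet_width z norm_divide power2_eq_square mult.commute)
    qed
    then have "sqrt q \<le> 1 / 2" by (intro real_le_lsqrt) auto
    moreover have "0 < sqrt q" using n \<zeta>0 by (simp add: q_def norm_packet_width z)
    ultimately have "pi / 4 \<le> pi / (8 * sqrt q)" by (intro divide_left_mono) auto
    also have "\<dots> = norm (packet_amp n * (sqrt pi / (4 * csqrt z)))"
      by (simp add: q_def packet_amp_def norm_mult norm_divide real_sqrt_mult)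
    finally show ?thesis .
  qed
  moreover have "norm (exp (packet_dual n * (of_nat n)\<^sup>2)) = exp (real n)"
    using n by (simp add: norm_exp_eq_Re packet_dual_def power2_eq_square)
  moreover have "norm (schroedinger t (\<lambda>s. packet n (of_real s)) s) =
      norm (packet_amp n * (sqrt pi / (4 * csqrt z))) * norm (exp (packet_dual n * (of_nat n)\<^sup>2)) *
      norm (exp (- (s - k)\<^sup>2 / (4 * z)) - exp (- (s + k)\<^sup>2 / (4 * z))) / sinh s"
    unfolding schroedinger_packet[OF n s] k z_def[symmetric] norm_mult norm_divide using s by (simp add: mult_ac)
  ultimately show ?thesis
    using s by (simp only:) (intro divide_right_mono mult_mono, auto)
qed

text \<open>
  Every $s$ between $2$ and $4$ is visited by the packet at a time of its own between $0$ and
  $1/n \le 1$, so the maximal function has the full height of the packet on a set of fixed size.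
\<close>

lemma maximal_packet_ge:
  assumes n: "n > 0"
  shows "ennreal (exp (2 * real n) / 2) \<le> radial_L1_norm_ball 4 (schroedinger_maximal (\<lambda>s. packet n (of_real s)))"
proof -
  let ?S = "schroedinger_maximal (\<lambda>s. packet n (of_real s))"
  have "ennreal (exp (2 * real n) / 4) \<le> ?S s * ennreal ((sinh s)\<^sup>2)" if s: "s \<in> {2<..<4}" for s :: real
  proof -
    define \<theta> where "\<theta> = (s - 2) / 2"
    define t where "t = (1 - \<theta>) / n"
    have \<theta>: "0 < \<theta>" "\<theta> < 1" "s = 2 + 2 * \<theta>" using s by (auto simp: \<theta>_def field_simps)
    have t: "t \<in> {0<..<1}" using \<theta> n by (auto simp: t_def field_simps)
    have "sinh s \<ge> s / 2"
    proof -
      have "(1 + s) - 1 \<le> exp s - exp (- s)"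
        using s by (intro diff_mono exp_ge_add_one_self) simp
      then show ?thesis by (simp add: sinh_field_def)
    qed
    then have sinh: "sinh s \<ge> 1" using s by simp
    define M where "M = norm (schroedinger t (\<lambda>s. packet n (of_real s)) s)"
    have M: "pi / 4 * exp (real n) * (exp (real n) - 1) / sinh s \<le> M"
      using norm_schroedinger_packet_ge[OF n \<theta>(1,2)] by (simp add: M_def t_def \<theta>(3))
    have "exp (real n) \<ge> 2" using exp_ge_add_one_self[of "real n"] n by linarith
    then have "exp (real n) / 2 \<le> exp (real n) - 1" by simp
    then have "1 / 2 * exp (real n) * (exp (real n) / 2) * 1 \<le> pi / 4 * exp (real n) * (exp (real n) - 1) * sinh s"
      using sinh pi_ge_two by (intro mult_mono) auto
    also have "\<dots> = pi / 4 * exp (real n) * (exp (real n) - 1) / sinh s * (sinh s)\<^sup>2"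
      using sinh by (simp add: power2_eq_square)
    also have "\<dots> \<le> M * (sinh s)\<^sup>2" using M by (intro mult_right_mono) auto
    finally have "exp (2 * real n) / 4 \<le> M * (sinh s)\<^sup>2"
      by (simp add: exp_double power2_eq_square)
    then have "ennreal (exp (2 * real n) / 4) \<le> ennreal M * ennreal ((sinh s)\<^sup>2)"
      by (simp add: ennreal_mult[symmetric] M_def ennreal_leI)
    also have "\<dots> \<le> ?S s * ennreal ((sinh s)\<^sup>2)"
      unfolding schroedinger_maximal_def M_def using t by (intro mult_right_mono SUP_upper) auto
    finally show ?thesis .
  qed
  then have "(\<integral>\<^sup>+s. ennreal (exp (2 * real n) / 4) * indicator {2::real<..<4} s \<partial>lborel) \<le>
      radial_L1_norm_ball 4 ?S"
    unfolding radial_L1_norm_ball_def by (intro nn_integral_mono) (auto split: split_indicator)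
  also have "(\<integral>\<^sup>+s. ennreal (exp (2 * real n) / 4) * indicator {2::real<..<4} s \<partial>lborel) = ennreal (exp (2 * real n) / 4) * ennreal 2"
    by (simp add: nn_integral_cmult_indicator)
  also have "\<dots> = ennreal (exp (2 * real n) / 2)"
    by (simp add: ennreal_mult[symmetric] del: ennreal_numeral)
  finally show ?thesis .
qed

section \<open>The Sobolev norm of the packets\<close>

text \<open>
  The weight is of size $n^{2\beta}$ near the frequency $n$. Away from it the loss is dominated by
  half of the Gaussian decay $e^{-2(\nu - n)^2/n}$ of the squared transform, which gives the factor
  $e^{(\nu - n)^2/n}$ here.
\<close>

lemma sobolev_weight_le:
  fixes \<nu> :: real
  assumes n: "n > 0" and "\<alpha> \<le> \<beta>" "0 \<le> \<beta>" "\<beta> \<le> 1"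
  shows "(\<nu>\<^sup>2 + 1) powr \<alpha> \<le> 4 * real n powr (2 * \<beta>) * exp ((\<nu> - real n)\<^sup>2 / n)"
proof -
  \<comment> \<open>Relative to its value at frequency \<open>n\<close> the weight grows at most linearly in \<open>w\<close>, and \<open>w\<close>
    itself is controlled by \<open>y\<close>.\<close>
  define w where "w = (\<nu>\<^sup>2 + 1) / (real n)\<^sup>2"
  define y where "y = (\<nu> - real n)\<^sup>2 / n"
  have n1: "real n \<ge> 1" using n by simp
  have w: "w > 0" using n by (simp add: w_def add_nonneg_pos)
  have "(\<nu>\<^sup>2 + 1) powr \<alpha> \<le> (\<nu>\<^sup>2 + 1) powr \<beta>"
    using assms by (intro powr_mono) auto
  also have "(\<nu>\<^sup>2 + 1) powr \<beta> = ((real n)\<^sup>2 * w) powr \<beta>"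
    using n by (simp add: w_def)
  also have "\<dots> = real n powr (2 * \<beta>) * w powr \<beta>"
    using n w by (simp add: powr_mult powr_powr flip: powr_numeral)
  finally have 1: "(\<nu>\<^sup>2 + 1) powr \<alpha> \<le> real n powr (2 * \<beta>) * w powr \<beta>" .
  have "w powr \<beta> \<le> 1 + w"
  proof (cases "w \<le> 1")
    case True
    then have "w powr \<beta> \<le> 1" using w assms by (intro powr_le1) auto
    then show ?thesis using w by linarith
  next
    case False
    then have "w powr \<beta> \<le> w powr 1" using assms by (intro powr_mono) auto
    then show ?thesis using w by simp
  qed
  also have "1 + w \<le> 4 + 2 * y"
  proof -
    have "\<nu>\<^sup>2 \<le> 2 * (\<nu> - real n)\<^sup>2 + 2 * (real n)\<^sup>2"
      using zero_le_power2[of "\<nu> - 2 * n"] by (simp add: power2_eq_square algebra_simps)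
    moreover have "1 \<le> (real n)\<^sup>2" using n1 by (simp add: one_le_power)
    ultimately have "w \<le> (2 * (\<nu> - real n)\<^sup>2 + 3 * (real n)\<^sup>2) / (real n)\<^sup>2"
      unfolding w_def by (intro divide_right_mono) auto
    also have "\<dots> = 3 + 2 * ((\<nu> - real n)\<^sup>2 / (real n)\<^sup>2)" using n by (simp add: field_simps)
    also have "(\<nu> - real n)\<^sup>2 / (real n)\<^sup>2 \<le> y"
      unfolding y_def using n1 by (intro divide_left_mono) (auto simp: power2_eq_square)
    finally show ?thesis by linarith
  qed
  also have "4 + 2 * y \<le> 4 * exp y"
  proof -
    have "y \<ge> 0" by (simp add: y_def)
    then show ?thesis using exp_ge_add_one_self[of y] by linarith
  qed
  finally have "real n powr (2 * \<beta>) * w powr \<beta> \<le> real n powr (2 * \<beta>) * (4 * exp y)"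
    by (rule mult_left_mono) simp
  with 1 show ?thesis by (simp add: y_def mult_ac)
qed

lemma norm_sin_le_exp: "norm (sin z) \<le> exp \<bar>Im z\<bar>"
proof -
  have "norm (exp (\<i> * z)) \<le> exp \<bar>Im z\<bar>" "norm (exp (- (\<i> * z))) \<le> exp \<bar>Im z\<bar>"
    by (auto simp: norm_exp_eq_Re)
  then have "norm (exp (\<i> * z) - exp (- (\<i> * z))) \<le> exp \<bar>Im z\<bar> + exp \<bar>Im z\<bar>"
    by (intro order.trans[OF norm_triangle_ineq4] add_mono)
  then show ?thesis by (simp add: sin_exp_eq norm_divide norm_mult)
qed

text \<open>
  The transform is a bump around the frequency $n$ of width $n^{1/2}$: the sine contributes
  $e^{2\nu}$ because its argument is $(2 + 2i)\nu$, and this moves the centre of the Gaussian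
  $e^{n - \nu^2/n}$ from $0$ to $n$.
\<close>

lemma norm_spherical_transform_packet_le:
  assumes n: "n > 0" and \<nu>: "\<nu> > 0"
  shows "(norm (spherical_transform (\<lambda>s. packet n (of_real s)) \<nu>))\<^sup>2 * \<nu>\<^sup>2 \<le>
    sqrt 2 * pi / n * exp (4 * real n) * exp (- 2 * ((\<nu> - real n)\<^sup>2 / n))"
proof -
  let ?E = "exp (packet_dual n * ((of_nat n)\<^sup>2 - (of_real \<nu>)\<^sup>2))" and ?k = "2 * packet_dual n * of_nat n"
  have "norm (spherical_transform (\<lambda>s. packet n (of_real s)) \<nu>) * \<nu> = norm (packet_amp n) * (norm ?E * norm (sin (?k * \<nu>)))"
    unfolding spherical_transform_packet[OF n \<nu>] using \<nu> by (simp add: norm_mult norm_divide)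
  also have "\<dots> \<le> norm (packet_amp n) * (exp (((real n)\<^sup>2 - \<nu>\<^sup>2) / real n) * exp (2 * \<nu>))"
  proof (intro mult_mono)
    show "norm ?E \<le> exp (((real n)\<^sup>2 - \<nu>\<^sup>2) / real n)"
      using n by (simp add: norm_exp_eq_Re packet_dual_def field_simps power2_eq_square)
    show "norm (sin (?k * \<nu>)) \<le> exp (2 * \<nu>)"
      using norm_sin_le_exp[of "?k * \<nu>"] n \<nu> by (simp add: packet_dual_def)
  qed auto
  also have "exp (((real n)\<^sup>2 - \<nu>\<^sup>2) / real n) * exp (2 * \<nu>) = exp (2 * real n - (\<nu> - real n)\<^sup>2 / n)"
    unfolding mult_exp_exp using n by (simp add: field_simps power2_eq_square)
  finally have "(norm (spherical_transform (\<lambda>s. packet n (of_real s)) \<nu>) * \<nu>)\<^sup>2 \<le>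
      (norm (packet_amp n) * exp (2 * real n - (\<nu> - real n)\<^sup>2 / n))\<^sup>2"
    using \<nu> by (intro power_mono) auto
  also have "\<dots> = sqrt 2 * pi / n * exp (2 * (2 * real n - (\<nu> - real n)\<^sup>2 / n))"
    by (simp only: power_mult_distrib norm_packet_amp_squared[OF n] exp_double)
  also have "2 * (2 * real n - (\<nu> - real n)\<^sup>2 / n) = 4 * real n + - 2 * ((\<nu> - real n)\<^sup>2 / n)" by simp
  finally show ?thesis by (simp only: exp_add power_mult_distrib mult.assoc of_nat_mult of_nat_numeral)
qed

text \<open>
  In the square of the norm the integral over the bump gives a factor $n^{1/2}$ and the amplitude a
  factor $n^{-1}$; this is the source of the exponent $\beta - 1/4$.
\<close>

lemma sobolev_norm_packet_le:
  assumes n: "n > 0" and "\<alpha> \<le> \<beta>" "0 \<le> \<beta>" "\<beta> \<le> 1"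
  shows "sobolev_norm \<alpha> (\<lambda>s. packet n (of_real s)) \<le>
    sqrt (4 * sqrt 2 * pi * sqrt pi) * (exp (2 * real n) * real n powr (\<beta> - 1 / 4))"
proof -
  define A where "A = 4 * real n powr (2 * \<beta>) * (sqrt 2 * pi / n * exp (4 * real n))"
  let ?F = "\<lambda>\<nu>::real. (\<nu>\<^sup>2 + 1) powr \<alpha> * (norm (spherical_transform (\<lambda>s. packet n (of_real s)) \<nu>))\<^sup>2 * \<nu>\<^sup>2"
  have gauss: "has_bochner_integral lborel (\<lambda>\<nu>. A * exp (- (1 / n * (\<nu> - real n)\<^sup>2))) (A * sqrt (pi / (1 / n)))"
    using n by (intro has_bochner_integral_mult_right has_bochner_integral_gaussian_real) auto
  have bound: "?F \<nu> \<le> A * exp (- (1 / n * (\<nu> - real n)\<^sup>2))" if "\<nu> > 0" for \<nu>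
  proof -
    define y where "y = (\<nu> - real n)\<^sup>2 / n"
    have "?F \<nu> \<le> (4 * real n powr (2 * \<beta>) * exp y) * (sqrt 2 * pi / n * exp (4 * real n) * exp (- 2 * y))"
      unfolding mult.assoc[of "(\<nu>\<^sup>2 + 1) powr \<alpha>"] y_def
      by (intro mult_mono sobolev_weight_le assms norm_spherical_transform_packet_le that) auto
    also have "\<dots> = A * (exp y * exp (- 2 * y))" by (simp add: A_def)
    also have "exp y * exp (- 2 * y) = exp (- y)" unfolding mult_exp_exp by simp
    finally show ?thesis by (simp add: y_def)
  qed
  have "(LINT \<nu>:{0<..}|lborel. ?F \<nu>) \<le> (LINT \<nu>|lborel. A * exp (- (1 / n * (\<nu> - real n)\<^sup>2)))"
    unfolding set_lebesgue_integral_def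
    by (rule integral_mono')
       (use gauss bound in \<open>auto simp: has_bochner_integral_iff A_def split: split_indicator\<close>)
  also have "\<dots> = A * sqrt (pi * n)"
    using gauss by (simp add: has_bochner_integral_iff)
  finally have "sobolev_norm \<alpha> (\<lambda>s. packet n (of_real s)) \<le> sqrt (A * sqrt (pi * n))"
    unfolding sobolev_norm_def by (rule real_sqrt_le_mono)
  also have "A * sqrt (pi * n) = (4 * sqrt 2 * pi * sqrt pi) * (exp (2 * real n) * real n powr (\<beta> - 1 / 4))\<^sup>2"
  proof -
    have "(real n powr (\<beta> - 1 / 4))\<^sup>2 = real n powr (2 * \<beta> - 1 + 1 / 2)"
      by (simp add: power2_eq_square flip: powr_add)
    also have "\<dots> = real n powr (2 * \<beta>) / n * sqrt n"
      using n by (simp only: powr_add powr_diff) (simp add: powr_half_sqrt)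
    finally show ?thesis
      by (simp add: A_def power_mult_distrib real_sqrt_mult exp_double[symmetric])
  qed
  also have "sqrt \<dots> = sqrt (4 * sqrt 2 * pi * sqrt pi) * (exp (2 * real n) * real n powr (\<beta> - 1 / 4))"
    by (simp only: real_sqrt_mult[of "4 * sqrt 2 * pi * sqrt pi"] real_sqrt_abs) simp
  finally show ?thesis .
qed

section \<open>Failure of the maximal inequality\<close>

theorem theorem1p4:
  fixes \<alpha> :: real
  assumes "\<alpha> < 1 / 4"
  shows "\<not> (\<forall>R>0. \<exists>c>0. \<forall>f. radial_L2_schwartz f \<longrightarrow>
           radial_L1_norm_ball R (schroedinger_maximal f) \<le> ennreal (c * sobolev_norm \<alpha> f))"
proof
  assume *: "\<forall>R>0. \<exists>c>0. \<forall>f. radial_L2_schwartz f \<longrightarrow>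
           radial_L1_norm_ball R (schroedinger_maximal f) \<le> ennreal (c * sobolev_norm \<alpha> f)"
  from *[rule_format, of 4] obtain c where c: "c > 0"
    and max_le: "\<And>f. radial_L2_schwartz f \<Longrightarrow>
           radial_L1_norm_ball 4 (schroedinger_maximal f) \<le> ennreal (c * sobolev_norm \<alpha> f)"
    by auto
  \<comment> \<open>Replacing a negative \<open>\<alpha>\<close> by \<open>0\<close> only enlarges the norm.\<close>
  define \<beta> where "\<beta> = max \<alpha> 0"
  define C where "C = sqrt (4 * sqrt 2 * pi * sqrt pi)"
  have \<beta>: "\<alpha> \<le> \<beta>" "0 \<le> \<beta>" "\<beta> < 1 / 4" using assms by (auto simp: \<beta>_def)
  have "1 / 2 \<le> c * C * real n powr (\<beta> - 1 / 4)" if n: "n > 0" for n :: nat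
  proof -
    have "ennreal (exp (2 * real n) / 2) \<le> ennreal (c * sobolev_norm \<alpha> (\<lambda>s. packet n (of_real s)))"
      using maximal_packet_ge[OF n] max_le[OF packet_schwartz[OF n]] by (rule order.trans)
    also have "\<dots> \<le> ennreal (c * (C * (exp (2 * real n) * real n powr (\<beta> - 1 / 4))))"
      unfolding C_def using c \<beta> n by (intro ennreal_leI mult_left_mono sobolev_norm_packet_le) auto
    finally have "exp (2 * real n) / 2 \<le> c * (C * (exp (2 * real n) * real n powr (\<beta> - 1 / 4)))"
      using c by (subst (asm) ennreal_le_iff) (auto simp: C_def)
    then have "exp (2 * real n) * (1 / 2) \<le> exp (2 * real n) * (c * C * real n powr (\<beta> - 1 / 4))"
      by (simp add: mult_ac)
    then show ?thesis by (subst (asm) mult_le_cancel_left_pos) auto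
  qed
  then have "eventually (\<lambda>n. 1 / 2 \<le> c * C * real n powr (\<beta> - 1 / 4)) sequentially"
    using eventually_gt_at_top[of "0::nat"] by (rule eventually_mono[rotated])
  moreover have "(\<lambda>n. c * C * real n powr (\<beta> - 1 / 4)) \<longlonglongrightarrow> c * C * 0"
    using \<beta> by (intro tendsto_mult_left tendsto_neg_powr filterlim_real_sequentially) auto
  ultimately have "1 / 2 \<le> c * C * 0"
    by (intro tendsto_lowerbound) auto
  then show False by simp
qed

end
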